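(* Let $n$ be even and let $\rho$ be a density operator on $n$ qubits, $\mathcal{A}=\{A_1,\dots,A_n\}$ with each $\mathcal{H}_{A_i}=\mathbb{C}^2$. Consider the filtration defined by the $2$-deformed total correlation $C_2$. Then $$\widetilde{\mathfrak{X}}_2(\infty)=I_2(\mathcal{A})_\rho=Q_{(n)}^2=\tau_n(\rho).$$
   Context: For nonempty $J\subseteq\mathcal{A}$, $\rho_J$ is the reduced state, $S_2(J)_\rho=1-\operatorname{Tr}\rho_J^2$ (linear entropy), $C_2(J)_\rho=\sum_{v\in J}S_2(\{v\})_\rho-S_2(J)_\rho$, and $I_2(\mathcal{A})_\rho=\sum_{\varnothing\ne J\subseteq\mathcal{A}}(-1)^{|J|-1}S_2(J)_\rho$. Let $\Delta$ be the set of nonempty subsets of $\mathcal{A}$ and $G(\varepsilon)_\rho=\{J\in\Delta:C_2(J)_\rho\le\varepsilon\}$, a filtration of simplicial complexes. Reduced Betti numbers: $\widetilde\beta_k(\varepsilon)=\operatorname{rank}H_k(G(\varepsilon)_\rho;\mathbb{Z}_2)$ for $k>0$, $\widetilde\beta_0(\varepsilon)=\max(\operatorname{rank}H_0(G(\varepsilon)_\rho;\mathbb{Z}_2)-1,0)$; the reduced integrated Euler characteristic is $\widetilde{\mathfrak{X}}_2(\infty)=\sum_{k\ge0}(-1)^k\int_0^\infty\widetilde\beta_k(\varepsilon)d\varepsilon$. Let $\sigma_0=I_2$ and $\sigma_1,\sigma_2,\sigma_3$ the Pauli matrices. For a multi-index $\iota=(i_1,\dots,i_n)\in\{0,1,2,3\}^n$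 set $Q_\iota=\operatorname{Tr}(\rho(\sigma_{i_1}\otimes\cdots\otimes\sigma_{i_n}))$ and let $|\iota|$ be the number of $j$ with $i_j\neq0$. The Minkowski length of the generalized Bloch vector is $Q_{(n)}^2=\frac{1}{2^n}\sum_{\iota\in\{0,1,2,3\}^n}(-1)^{|\iota|}Q_\iota^2$. The $n$-tangle is $\tau_n(\rho)=\operatorname{Tr}(\rho\,\sigma_2^{\otimes n}\rho^*\sigma_2^{\otimes n})$, with $\rho^*$ the entrywise complex conjugate in the computational basis. *)

theory Defs
  imports "HOL-Analysis.Analysis"
begin

text \<open>Qubits are labelled 0,...,n-1 (the set A). A computational basis state of the
subsystem J is an extensional function J \<rightarrow> bool (False = |0>, True = |1>).
An operator on the full system is a function on pairs of basis states of {0..<n}.\<close>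

definition configs :: "nat set \<Rightarrow> (nat \<Rightarrow> bool) set" where
  "configs J = J \<rightarrow>\<^sub>E (UNIV :: bool set)"

definition density_op :: "nat \<Rightarrow> ((nat \<Rightarrow> bool) \<Rightarrow> (nat \<Rightarrow> bool) \<Rightarrow> complex) \<Rightarrow> bool" where
  "density_op n \<rho> \<longleftrightarrow>
     (\<forall>x\<in>configs {0..<n}. \<forall>y\<in>configs {0..<n}. \<rho> y x = cnj (\<rho> x y)) \<and>
     (\<forall>v :: (nat \<Rightarrow> bool) \<Rightarrow> complex.
        Im (\<Sum>x\<in>configs {0..<n}. \<Sum>y\<in>configs {0..<n}. cnj (v x) * \<rho> x y * v y) = 0 \<and>
        Re (\<Sum>x\<in>configs {0..<n}. \<Sum>y\<in>configs {0..<n}. cnj (v x) * \<rho> x y * v y) \<ge> 0) \<and>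
     (\<Sum>x\<in>configs {0..<n}. \<rho> x x) = 1"

definition join :: "nat set \<Rightarrow> (nat \<Rightarrow> bool) \<Rightarrow> (nat \<Rightarrow> bool) \<Rightarrow> (nat \<Rightarrow> bool)" where
  "join J x z = (\<lambda>i. if i \<in> J then x i else z i)"

definition reduced :: "nat \<Rightarrow> ((nat \<Rightarrow> bool) \<Rightarrow> (nat \<Rightarrow> bool) \<Rightarrow> complex) \<Rightarrow> nat set
    \<Rightarrow> (nat \<Rightarrow> bool) \<Rightarrow> (nat \<Rightarrow> bool) \<Rightarrow> complex" where
  "reduced n \<rho> J x y = (\<Sum>z\<in>configs ({0..<n} - J). \<rho> (join J x z) (join J y z))"

text \<open>Linear entropy S_2(J) = 1 - Tr rho_J^2 (the trace is real for Hermitian rho).\<close>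
definition S2 :: "nat \<Rightarrow> ((nat \<Rightarrow> bool) \<Rightarrow> (nat \<Rightarrow> bool) \<Rightarrow> complex) \<Rightarrow> nat set \<Rightarrow> real" where
  "S2 n \<rho> J = 1 - Re (\<Sum>x\<in>configs J. \<Sum>y\<in>configs J. reduced n \<rho> J x y * reduced n \<rho> J y x)"

definition C2 :: "nat \<Rightarrow> ((nat \<Rightarrow> bool) \<Rightarrow> (nat \<Rightarrow> bool) \<Rightarrow> complex) \<Rightarrow> nat set \<Rightarrow> real" where
  "C2 n \<rho> J = (\<Sum>v\<in>J. S2 n \<rho> {v}) - S2 n \<rho> J"

definition I2 :: "nat \<Rightarrow> ((nat \<Rightarrow> bool) \<Rightarrow> (nat \<Rightarrow> bool) \<Rightarrow> complex) \<Rightarrow> real" where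
  "I2 n \<rho> = (\<Sum>J\<in>Pow {0..<n} - {{}}. (-1) ^ (card J - 1) * S2 n \<rho> J)"

definition Gfilt :: "nat \<Rightarrow> ((nat \<Rightarrow> bool) \<Rightarrow> (nat \<Rightarrow> bool) \<Rightarrow> complex) \<Rightarrow> real \<Rightarrow> nat set set" where
  "Gfilt n \<rho> \<epsilon> = {J. J \<subseteq> {0..<n} \<and> J \<noteq> {} \<and> C2 n \<rho> J \<le> \<epsilon>}"

text \<open>A simplicial complex K is a set of nonempty finite vertex sets; k-simplices have
k+1 vertices. A Z_2-chain is a finite set of simplices (addition = symmetric difference).
The boundary of a chain c consists of the (nonempty) codimension-one faces that occur an odd
number of times; the boundary of 0-chains is zero.\<close>

definition ksimplices :: "nat set set \<Rightarrow> nat \<Rightarrow> nat set set" where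
  "ksimplices K k = {s \<in> K. card s = k + 1}"

definition bd :: "nat set set \<Rightarrow> nat set set" where
  "bd c = {f. f \<noteq> {} \<and> odd (card {s \<in> c. \<exists>v\<in>s. f = s - {v}})}"

definition cycles :: "nat set set \<Rightarrow> nat \<Rightarrow> nat set set set" where
  "cycles K k = {c. c \<subseteq> ksimplices K k \<and> bd c = {}}"

definition boundaries :: "nat set set \<Rightarrow> nat \<Rightarrow> nat set set set" where
  "boundaries K k = bd ` Pow (ksimplices K (k + 1))"

text \<open>rank H_k(K;Z_2) = dim_{Z_2}(Z_k/B_k); since |Z_k/B_k| = 2^dim, this is the d with
|Z_k| = 2^d |B_k|.\<close>
definition hrank :: "nat set set \<Rightarrow> nat \<Rightarrow> nat" where
  "hrank K k = (THE d. card (cycles K k) = 2 ^ d * card (boundaries K k))"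

definition rbetti :: "nat set set \<Rightarrow> nat \<Rightarrow> nat" where
  "rbetti K k = (if k = 0 then hrank K 0 - 1 else hrank K k)"

definition euler_int :: "nat \<Rightarrow> ((nat \<Rightarrow> bool) \<Rightarrow> (nat \<Rightarrow> bool) \<Rightarrow> complex) \<Rightarrow> real" where
  "euler_int n \<rho> = (\<Sum>k. (-1) ^ k * integral {0..} (\<lambda>\<epsilon>. real (rbetti (Gfilt n \<rho> \<epsilon>) k)))"

definition pauli :: "nat \<Rightarrow> bool \<Rightarrow> bool \<Rightarrow> complex" where
  "pauli i a b =
    (if i = 0 then (if a = b then 1 else 0)
     else if i = 1 then (if a = b then 0 else 1)
     else if i = 2 then (if a = b then 0 else if a then \<i> else - \<i>)
     else (if a = b then (if a then -1 else 1) else 0))"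

definition Qcoef :: "nat \<Rightarrow> ((nat \<Rightarrow> bool) \<Rightarrow> (nat \<Rightarrow> bool) \<Rightarrow> complex) \<Rightarrow> (nat \<Rightarrow> nat) \<Rightarrow> complex" where
  "Qcoef n \<rho> \<iota> = (\<Sum>x\<in>configs {0..<n}. \<Sum>y\<in>configs {0..<n}.
      \<rho> x y * (\<Prod>j<n. pauli (\<iota> j) (y j) (x j)))"

definition Qsq :: "nat \<Rightarrow> ((nat \<Rightarrow> bool) \<Rightarrow> (nat \<Rightarrow> bool) \<Rightarrow> complex) \<Rightarrow> complex" where
  "Qsq n \<rho> = (1 / 2 ^ n) * (\<Sum>\<iota>\<in>{0..<n} \<rightarrow>\<^sub>E {0..<4}.
      (-1) ^ card {j \<in> {0..<n}. \<iota> j \<noteq> 0} * (Qcoef n \<rho> \<iota>)\<^sup>2)"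

definition sigmaY_n :: "nat \<Rightarrow> (nat \<Rightarrow> bool) \<Rightarrow> (nat \<Rightarrow> bool) \<Rightarrow> complex" where
  "sigmaY_n n x y = (\<Prod>j<n. pauli 2 (x j) (y j))"

definition tangle :: "nat \<Rightarrow> ((nat \<Rightarrow> bool) \<Rightarrow> (nat \<Rightarrow> bool) \<Rightarrow> complex) \<Rightarrow> complex" where
  "tangle n \<rho> = (\<Sum>a\<in>configs {0..<n}. \<Sum>b\<in>configs {0..<n}. \<Sum>c\<in>configs {0..<n}. \<Sum>d\<in>configs {0..<n}.
      \<rho> a b * sigmaY_n n b c * cnj (\<rho> c d) * sigmaY_n n d a)"

end

theory Submission
  imports Defs "HOL-Computational_Algebra.Primes"
begin

text \<open>Let \<open>F J\<close> flip the qubits in \<open>J\<close> between two copies of the system. The purity of the reduced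
  state on \<open>J\<close> is the expectation of \<open>F J\<close> in \<open>\<rho> \<otimes> \<rho>\<close>, so the alternating sum \<open>I2\<close> is the
  expectation of the tensor power of \<open>1 - F\<close>. On one pair of qubits \<open>1 - F\<close> is half of
  \<open>1 - X \<otimes> X - Y \<otimes> Y - Z \<otimes> Z\<close>, which gives \<open>Qsq\<close>, and it is twice the projection onto the singlet,
  which gives the tangle.

  For disjoint \<open>J\<close> and \<open>L\<close> the operator \<open>(1 - F J) (1 - F L)\<close> is positive, so the linear entropy is
  subadditive, \<open>C2\<close> is monotone and the filtration consists of simplicial complexes. By the
  Euler-Poincare formula the alternating sum of the integrated reduced Betti numbers is the
  integral of a sum of step functions jumping at the values of \<open>C2\<close>. It converges because the
  complex is eventually a full simplex, and it evaluates to the negated alternating sum of \<open>C2\<close>; for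
  two or more qubits the one-qubit entropies cancel there, leaving \<open>I2\<close>.\<close>

section \<open>Homology of finite complexes over the two-element field\<close>

lemma odd_card_sym_diff:
  assumes "finite A" "finite B"
  shows "odd (card (sym_diff A B)) \<longleftrightarrow> odd (card A) \<noteq> odd (card B)"
proof -
  have "card (sym_diff A B) = card (A - B) + card (B - A)"
    using assms by (intro card_Un_disjoint) auto
  moreover have "card A = card (A - B) + card (A \<inter> B)"
    using assms by (metis add.commute card_Int_Diff)
  moreover have "card B = card (B - A) + card (A \<inter> B)"
    using assms by (metis add.commute card_Int_Diff inf_commute)
  ultimately show ?thesis by auto
qed

text \<open>Under symmetric difference the subsets of \<open>X\<close> form a vector space over the
  two-element field and \<open>T\<close> is linear on it. Translation by a preimage of
  \<open>y\<close> carries the fibre over \<open>y\<close> bijectively onto the kernel, so all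
  fibres have equal size.\<close>

lemma card_kernel_times_card_image:
  fixes T :: "'a set \<Rightarrow> 'b set"
  assumes "finite X"
    and add: "\<And>c d. c \<subseteq> X \<Longrightarrow> d \<subseteq> X \<Longrightarrow> T (sym_diff c d) = sym_diff (T c) (T d)"
  shows "card {c. c \<subseteq> X \<and> T c = {}} * card (T ` Pow X) = 2 ^ card X"
proof -
  let ?Z = "{c. c \<subseteq> X \<and> T c = {}}"
  have fib: "card {c \<in> Pow X. T c = y} = card ?Z" if y: "y \<in> T ` Pow X" for y
  proof -
    obtain d where d: "d \<subseteq> X" "y = T d" using y by auto
    have cancel: "sym_diff (sym_diff c d) d = c" for c by auto
    have "T (sym_diff c d) = {}" if "c \<subseteq> X" "T c = y" for c
      using add[OF that(1) d(1)] that d by auto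
    moreover have "T (sym_diff c d) = y" if "c \<subseteq> X" "T c = {}" for c
      using add[OF that(1) d(1)] that d by auto
    ultimately have "bij_betw (\<lambda>c. sym_diff c d) {c \<in> Pow X. T c = y} ?Z"
      using d by (intro bij_betwI[where g = "\<lambda>c. sym_diff c d"]) (auto simp del: Un_iff simp: cancel)
    then show ?thesis by (rule bij_betw_same_card)
  qed
  have "card (Pow X) = (\<Sum>y\<in>T ` Pow X. card {c \<in> Pow X. T c = y})"
    using assms(1) sum.image_gen[of "Pow X" "\<lambda>_. 1::nat" T] by simp
  also have "\<dots> = card (T ` Pow X) * card ?Z"
    using fib by simp
  finally show ?thesis using assms(1) by (simp add: card_Pow mult.commute)
qed

text \<open>Both cardinalities divide a power of two, hence are powers of two; the exponents serve
  as dimensions.\<close>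

lemma kernel_image_ranks:
  fixes T :: "'a set \<Rightarrow> 'b set"
  assumes "finite X"
    and "\<And>c d. c \<subseteq> X \<Longrightarrow> d \<subseteq> X \<Longrightarrow> T (sym_diff c d) = sym_diff (T c) (T d)"
  obtains z b where "card {c. c \<subseteq> X \<and> T c = {}} = 2 ^ z" "card (T ` Pow X) = 2 ^ b"
    "z + b = card X"
proof -
  have eq: "card {c. c \<subseteq> X \<and> T c = {}} * card (T ` Pow X) = 2 ^ card X"
    by (rule card_kernel_times_card_image[OF assms])
  obtain z where z: "card {c. c \<subseteq> X \<and> T c = {}} = 2 ^ z"
    using eq by (metis divides_primepow_nat dvd_triv_left two_is_prime_nat)
  obtain b where b: "card (T ` Pow X) = 2 ^ b"
    using eq by (metis divides_primepow_nat dvd_triv_right two_is_prime_nat)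
  have "(2::nat) ^ (z + b) = 2 ^ card X" using eq z b by (simp add: power_add)
  then show ?thesis using that z b by simp
qed

section \<open>The boundary map modulo two\<close>

lemma bd_sym_diff:
  assumes "finite c" "finite d"
  shows "bd (sym_diff c d) = sym_diff (bd c) (bd d)"
proof -
  have "{s \<in> sym_diff c d. \<exists>v\<in>s. f = s - {v}} =
      sym_diff {s \<in> c. \<exists>v\<in>s. f = s - {v}} {s \<in> d. \<exists>v\<in>s. f = s - {v}}" for f :: "nat set"
    by auto
  then show ?thesis
    unfolding bd_def using assms by (auto simp: odd_card_sym_diff simp del: Un_iff)
qed

lemma bd_empty [simp]: "bd {} = {}"
  by (simp add: bd_def)

lemma bd_singleton: "bd {s} = (\<lambda>v. s - {v}) ` s - {{}}"
proof -
  have "{t \<in> {s}. \<exists>v\<in>t. f = t - {v}} = (if f \<in> (\<lambda>v. s - {v}) ` s then {s} else {})" for f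
    by auto
  then show ?thesis unfolding bd_def by auto
qed

text \<open>A nonempty face of the form \<open>s - {v, w}\<close> with distinct \<open>v\<close>,
  \<open>w\<close> in \<open>s\<close> lies in exactly two facets of \<open>s\<close>, namely
  \<open>s - {v}\<close> and \<open>s - {w}\<close>; any other nonempty set arises from no facet by
  deleting a vertex. Both counts are even.\<close>

lemma bd_bd_singleton: "bd (bd {s}) = {}"
proof -
  have "even (card {g \<in> bd {s}. \<exists>v\<in>g. f = g - {v}})" if f: "f \<noteq> {}" for f
  proof (cases "\<exists>v w. v \<in> s \<and> w \<in> s \<and> v \<noteq> w \<and> f = s - {v, w}")
    case True
    then obtain v w where vw: "v \<in> s" "w \<in> s" "v \<noteq> w" "f = s - {v, w}" by blast
    have "{g \<in> bd {s}. \<exists>v\<in>g. f = g - {v}} = {s - {v}, s - {w}}"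
      using vw f unfolding bd_singleton by (auto; blast)
    moreover have "s - {v} \<noteq> s - {w}" using vw by auto
    ultimately show ?thesis by simp
  next
    case False
    then have none: "{g \<in> bd {s}. \<exists>v\<in>g. f = g - {v}} = {}"
      unfolding bd_singleton by (auto simp: Diff_insert2[symmetric])
    show ?thesis unfolding none by simp
  qed
  then show ?thesis unfolding bd_def[of "bd {s}"] by auto
qed

lemma finite_bd:
  assumes "finite c" "\<And>s. s \<in> c \<Longrightarrow> finite s"
  shows "finite (bd c)"
proof (rule finite_subset)
  show "bd c \<subseteq> (\<Union>s\<in>c. (\<lambda>v. s - {v}) ` s)"
  proof
    fix f assume "f \<in> bd c"
    then have "{s \<in> c. \<exists>v\<in>s. f = s - {v}} \<noteq> {}"
      unfolding bd_def by (metis (mono_tags, lifting) card.empty even_zero mem_Collect_eq)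
    then show "f \<in> (\<Union>s\<in>c. (\<lambda>v. s - {v}) ` s)" by blast
  qed
  show "finite (\<Union>s\<in>c. (\<lambda>v. s - {v}) ` s)" using assms by auto
qed

lemma bd_bd:
  assumes "finite c" "\<And>s. s \<in> c \<Longrightarrow> finite s"
  shows "bd (bd c) = {}"
  using assms
proof (induction c rule: finite_induct)
  case empty
  show ?case by simp
next
  case (insert s c)
  have "insert s c = sym_diff {s} c" using insert.hyps by auto
  then have "bd (bd (insert s c)) = bd (sym_diff (bd {s}) (bd c))"
    using bd_sym_diff[of "{s}" c] insert.hyps by simp
  also have "\<dots> = sym_diff (bd (bd {s})) (bd (bd c))"
    using insert by (intro bd_sym_diff finite_bd) auto
  finally show ?case using insert by (simp add: bd_bd_singleton)
qed

section \<open>Ranks of cycles and boundaries, and the Euler-Poincare formula\<close>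

locale finite_complex =
  fixes K :: "nat set set"
  assumes finite_K: "finite K"
    and simplex: "s \<in> K \<Longrightarrow> finite s \<and> s \<noteq> {}"
    and face: "s \<in> K \<Longrightarrow> v \<in> s \<Longrightarrow> s - {v} \<noteq> {} \<Longrightarrow> s - {v} \<in> K"
begin

lemma finite_ksimplices [simp]: "finite (ksimplices K k)"
  unfolding ksimplices_def using finite_K by simp

lemma finite_chain: "c \<subseteq> ksimplices K k \<Longrightarrow> finite c"
  using finite_ksimplices finite_subset by blast

lemma bd_chain:
  assumes "c \<subseteq> ksimplices K (Suc k)"
  shows "bd c \<subseteq> ksimplices K k"
proof
  fix f assume f: "f \<in> bd c"
  then have "{s \<in> c. \<exists>v\<in>s. f = s - {v}} \<noteq> {}"
    unfolding bd_def by (metis (mono_tags, lifting) card.empty even_zero mem_Collect_eq)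
  then obtain s v where s: "s \<in> c" "v \<in> s" "f = s - {v}" by blast
  have "f \<noteq> {}" using f by (simp add: bd_def)
  then show "f \<in> ksimplices K k"
    using s assms face[of s v] simplex[of s] by (auto simp: ksimplices_def)
qed

lemma face_nonempty:
  assumes "s \<in> ksimplices K (Suc k)"
  shows "s - {a} \<noteq> {}"
proof
  assume "s - {a} = {}"
  then have "card s \<le> card {a}" by (intro card_mono) auto
  then show False using assms by (simp add: ksimplices_def)
qed

lemma bd_vertices:
  assumes "c \<subseteq> ksimplices K 0"
  shows "bd c = {}"
proof -
  have "{s \<in> c. \<exists>v\<in>s. f = s - {v}} = {}" if "f \<noteq> {}" for f
    using assms that by (auto simp: ksimplices_def card_1_singleton_iff)
  then show ?thesis unfolding bd_def by (metis (mono_tags, lifting) Collect_empty_eq card.empty even_zero)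
qed

lemma boundaries_subset_cycles: "boundaries K k \<subseteq> cycles K k"
proof
  fix e assume "e \<in> boundaries K k"
  then obtain c where c: "c \<subseteq> ksimplices K (Suc k)" "e = bd c"
    by (auto simp: boundaries_def)
  then show "e \<in> cycles K k"
    using bd_chain[OF c(1)] simplex bd_bd[OF finite_chain[OF c(1)]]
    by (auto simp: cycles_def ksimplices_def)
qed

lemma cycles_0: "cycles K 0 = Pow (ksimplices K 0)"
  using bd_vertices by (auto simp: cycles_def)

lemma finite_cycles: "finite (cycles K k)"
  by (rule finite_subset[of _ "Pow (ksimplices K k)"]) (auto simp: cycles_def)

text \<open>Cycles in degree \<open>Suc k\<close> and boundaries in degree \<open>k\<close> are the
  kernel and the image of the same map, \<open>bd\<close> on the
  \<open>Suc k\<close>-chains.\<close>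

lemma rank_nullity:
  obtains z b where "card (cycles K (Suc k)) = 2 ^ z" "card (boundaries K k) = 2 ^ b"
    "z + b = card (ksimplices K (Suc k))"
proof -
  have "bd (sym_diff c d) = sym_diff (bd c) (bd d)"
    if "c \<subseteq> ksimplices K (Suc k)" "d \<subseteq> ksimplices K (Suc k)" for c d
    using that by (intro bd_sym_diff finite_chain)
  from kernel_image_ranks[OF finite_ksimplices this] show ?thesis
    using that unfolding cycles_def boundaries_def by auto
qed

definition cycle_rank :: "nat \<Rightarrow> nat" where
  "cycle_rank k = (THE d. card (cycles K k) = 2 ^ d)"

definition boundary_rank :: "nat \<Rightarrow> nat" where
  "boundary_rank k = (THE d. card (boundaries K k) = 2 ^ d)"

lemma cycle_rank_eqI: "card (cycles K k) = 2 ^ d \<Longrightarrow> cycle_rank k = d"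
  unfolding cycle_rank_def by (intro the_equality) auto

lemma boundary_rank_eqI: "card (boundaries K k) = 2 ^ d \<Longrightarrow> boundary_rank k = d"
  unfolding boundary_rank_def by (intro the_equality) auto

lemma cycle_rank_0: "cycle_rank 0 = card (ksimplices K 0)"
  by (rule cycle_rank_eqI) (simp add: cycles_0 card_Pow)

lemma cycle_rank_Suc: "cycle_rank (Suc k) + boundary_rank k = card (ksimplices K (Suc k))"
  using rank_nullity[of k] cycle_rank_eqI boundary_rank_eqI by metis

lemma card_cycles: "card (cycles K k) = 2 ^ cycle_rank k"
proof (cases k)
  case 0
  then show ?thesis by (simp add: cycles_0 card_Pow cycle_rank_0)
next
  case (Suc j)
  then show ?thesis using rank_nullity[of j] cycle_rank_eqI by metis
qed

lemma card_boundaries: "card (boundaries K k) = 2 ^ boundary_rank k"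
  using rank_nullity[of k] boundary_rank_eqI by metis

lemma boundary_rank_le: "boundary_rank k \<le> cycle_rank k"
  using card_mono[OF finite_cycles boundaries_subset_cycles, of k]
  by (simp add: card_cycles card_boundaries)

lemma hrank_eq: "hrank K k = cycle_rank k - boundary_rank k"
  unfolding hrank_def card_cycles card_boundaries
proof (rule the_equality)
  show "(2::nat) ^ cycle_rank k = 2 ^ (cycle_rank k - boundary_rank k) * 2 ^ boundary_rank k"
    using boundary_rank_le by (simp flip: power_add)
  show "d = cycle_rank k - boundary_rank k"
    if "(2::nat) ^ cycle_rank k = 2 ^ d * 2 ^ boundary_rank k" for d
    using that by (simp flip: power_add)
qed

text \<open>Each boundary rank enters the Betti numbers of two adjacent degrees, so the alternating
  sum telescopes.\<close>

lemma Euler_Poincare: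
  assumes "ksimplices K N = {}"
  shows "(\<Sum>k<N. (-1) ^ k * real (hrank K k)) = (\<Sum>k<N. (-1) ^ k * real (card (ksimplices K k)))"
proof -
  \<comment> \<open>\<open>b' k\<close> is the rank of \<open>bd\<close> on \<open>k\<close>-chains;
    it is 0 in degree 0, where every chain is a cycle.\<close>
  define b' where "b' k = (case k of 0 \<Rightarrow> 0 | Suc j \<Rightarrow> real (boundary_rank j))" for k
  have h: "real (hrank K k) = real (card (ksimplices K k)) - b' k - b' (Suc k)" for k
    using boundary_rank_le[of k]
    by (cases k) (auto simp: hrank_eq cycle_rank_0 b'_def of_nat_diff simp flip: cycle_rank_Suc)
  have "(\<Sum>k<M. (-1) ^ k * real (hrank K k)) =
      (\<Sum>k<M. (-1) ^ k * real (card (ksimplices K k))) + (-1) ^ M * b' M" for M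
    by (induction M) (auto simp: h b'_def[of 0] algebra_simps)
  moreover have "b' N = 0"
    using cycle_rank_Suc[of "N - 1"] assms by (cases N) (auto simp: b'_def)
  ultimately show ?thesis by simp
qed

text \<open>An edge has two endpoints, so the boundary of every 1-chain consists of an even number
  of vertices, whereas a single vertex is a cycle of size one.\<close>

lemma hrank_0_pos:
  assumes "{a} \<in> K"
  shows "hrank K 0 > 0"
proof -
  have even: "even (card (bd c))" if "c \<subseteq> ksimplices K (Suc 0)" for c
    using finite_chain[OF that] that
  proof (induction c rule: finite_induct)
    case empty
    show ?case by simp
  next
    case (insert s c)
    have "insert s c = sym_diff {s} c" using insert.hyps by auto
    then have *: "bd (insert s c) = sym_diff (bd {s}) (bd c)"
      using bd_sym_diff[of "{s}" c] insert.hyps by simp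
    have "card s = 2" using insert.prems by (auto simp: ksimplices_def)
    then obtain v w where vw: "s = {v, w}" "v \<noteq> w" by (auto simp: card_2_iff)
    then have "bd {s} = {{w}, {v}}" unfolding bd_singleton by auto
    then have "even (card (bd {s}))" "finite (bd {s})" using vw by auto
    moreover have "finite (bd c)" using insert simplex
      by (intro finite_bd) (auto simp: ksimplices_def)
    ultimately show ?case
      using insert.IH insert.prems odd_card_sym_diff[of "bd {s}" "bd c"] unfolding * by blast
  qed
  have "{{a}} \<in> cycles K 0" using assms by (auto simp: cycles_0 ksimplices_def)
  moreover have "{{a}} \<notin> boundaries K 0"
  proof
    assume "{{a}} \<in> boundaries K 0"
    then obtain c where "c \<subseteq> ksimplices K (Suc 0)" "bd c = {{a}}"
      by (auto simp: boundaries_def)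
    then show False using even[of c] by simp
  qed
  ultimately have "boundaries K 0 \<subset> cycles K 0"
    using boundaries_subset_cycles by blast
  then have "card (boundaries K 0) < card (cycles K 0)"
    by (intro psubset_card_mono finite_cycles)
  then show ?thesis by (simp add: card_cycles card_boundaries hrank_eq)
qed

text \<open>In a cone with apex \<open>a\<close> the boundary is injective on the chains of simplices through
  \<open>a\<close>, because the faces opposite to \<open>a\<close> determine such a chain. Counting then gives enough
  boundaries to kill the reduced homology.\<close>

lemma inj_on_bd_star: "inj_on bd (Pow {s \<in> ksimplices K (Suc k). a \<in> s})"
proof (rule inj_onI)
  have rec: "s \<in> c \<longleftrightarrow> s - {a} \<in> bd c"
    if c: "c \<subseteq> {s \<in> ksimplices K (Suc k). a \<in> s}" and s: "s \<in> ksimplices K (Suc k)" "a \<in> s" for c s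
  proof -
    have "{t \<in> c. \<exists>v\<in>t. s - {a} = t - {v}} = (if s \<in> c then {s} else {})"
    proof -
      have "t = s" if "t \<in> c" "v \<in> t" "s - {a} = t - {v}" for t v
      proof -
        have "a \<in> t" using c that by auto
        then have "v = a" using that by blast
        then show ?thesis using that \<open>a \<in> t\<close> s by blast
      qed
      then show ?thesis using s by auto
    qed
    moreover have "s - {a} \<noteq> {}"
      using face_nonempty[OF s(1)] .
    ultimately show ?thesis unfolding bd_def by auto
  qed
  fix c d assume "c \<in> Pow {s \<in> ksimplices K (Suc k). a \<in> s}" "d \<in> Pow {s \<in> ksimplices K (Suc k). a \<in> s}"
    "bd c = bd d"
  then show "c = d" using rec[of c] rec[of d] by blast
qed

lemma rbetti_cone:
  assumes apex: "{a} \<in> K" and cone: "\<And>s. s \<in> K \<Longrightarrow> insert a s \<in> K"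
  shows "rbetti K k = 0"
proof -
  \<comment> \<open>Deleting the apex gives \<open>st (Suc k) = lk k\<close>, and injectivity of
    \<open>bd\<close> on the star gives \<open>st (Suc k) \<le> boundary_rank k\<close>. By
    rank-nullity the cycle rank in degree \<open>Suc j\<close> is then at most
    \<open>lk (Suc j) = st (Suc (Suc j))\<close>, hence at most the boundary rank; in degree 0 the
    apex itself contributes one more.\<close>
  define st where "st k = card {s \<in> ksimplices K k. a \<in> s}" for k
  define lk where "lk k = card {s \<in> ksimplices K k. a \<notin> s}" for k
  have split: "card (ksimplices K k) = st k + lk k" for k
  proof -
    have "card (ksimplices K k \<inter> {s. a \<in> s}) + card (ksimplices K k - {s. a \<in> s}) = card (ksimplices K k)"
      by (rule card_Int_Diff[symmetric]) simp
    moreover have "ksimplices K k \<inter> {s. a \<in> s} = {s \<in> ksimplices K k. a \<in> s}"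
      "ksimplices K k - {s. a \<in> s} = {s \<in> ksimplices K k. a \<notin> s}" by auto
    ultimately show ?thesis by (simp only: st_def lk_def)
  qed
  have "bij_betw (\<lambda>s. s - {a}) {s \<in> ksimplices K (Suc k). a \<in> s} {s \<in> ksimplices K k. a \<notin> s}" for k
  proof (rule bij_betwI[where g = "insert a"])
    show "(\<lambda>s. s - {a}) \<in> {s \<in> ksimplices K (Suc k). a \<in> s} \<rightarrow> {s \<in> ksimplices K k. a \<notin> s}"
    proof
      fix s assume "s \<in> {s \<in> ksimplices K (Suc k). a \<in> s}"
      then have s: "s \<in> K" "card s = k + 2" "a \<in> s" "s - {a} \<noteq> {}"
        using face_nonempty[of s k a] by (simp_all add: ksimplices_def)
      then have "card (s - {a}) = k + 1" by simp
      then show "s - {a} \<in> {s \<in> ksimplices K k. a \<notin> s}"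
        using face[OF s(1,3,4)] by (simp add: ksimplices_def)
    qed
    show "insert a \<in> {s \<in> ksimplices K k. a \<notin> s} \<rightarrow> {s \<in> ksimplices K (Suc k). a \<in> s}"
    proof
      fix s assume s: "s \<in> {s \<in> ksimplices K k. a \<notin> s}"
      then have "finite s" using simplex[of s] by (simp add: ksimplices_def)
      then show "insert a s \<in> {s \<in> ksimplices K (Suc k). a \<in> s}"
        using s cone[of s] by (simp add: ksimplices_def)
    qed
  qed auto
  then have st_lk: "st (Suc k) = lk k" for k
    unfolding st_def lk_def by (rule bij_betw_same_card)
  have st_b: "st (Suc k) \<le> boundary_rank k" for k
  proof -
    have "2 ^ st (Suc k) = card (bd ` Pow {s \<in> ksimplices K (Suc k). a \<in> s})"
      by (simp add: card_image[OF inj_on_bd_star] card_Pow st_def)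
    also have "\<dots> \<le> card (boundaries K k)"
      using finite_cycles boundaries_subset_cycles
      by (intro card_mono) (auto simp: boundaries_def intro: finite_subset)
    finally show ?thesis by (simp add: card_boundaries)
  qed
  have "{s \<in> ksimplices K 0. a \<in> s} = {{a}}"
    using apex by (auto simp: ksimplices_def card_1_singleton_iff)
  then have "st 0 = 1" by (simp add: st_def)
  then have "cycle_rank 0 \<le> boundary_rank 0 + 1"
    using cycle_rank_0 split[of 0] st_lk[of 0] st_b[of 0] by simp
  moreover have "cycle_rank (Suc j) \<le> boundary_rank (Suc j)" for j
    using cycle_rank_Suc[of j] split[of "Suc j"] st_lk[of "Suc j"] st_b[of j] st_b[of "Suc j"] by simp
  ultimately show ?thesis
    unfolding rbetti_def hrank_eq by (cases k) auto
qed

text \<open>The vertex \<open>{a}\<close> makes \<open>hrank K 0\<close> positive, so the truncated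
  subtraction in \<open>rbetti\<close> is exact and costs one. The remaining sum groups the
  simplices by dimension.\<close>

lemma reduced_Euler_Poincare:
  assumes "{a} \<in> K" and bound: "\<And>s. s \<in> K \<Longrightarrow> card s \<le> N"
  shows "(\<Sum>k<N. (-1) ^ k * real (rbetti K k)) = (\<Sum>s\<in>K. (-1) ^ (card s - 1)) - 1"
proof -
  have "N \<noteq> 0" using assms(1) bound[of "{a}"] by simp
  have r: "real (rbetti K k) = real (hrank K k) - (if k = 0 then 1 else 0)" for k
    using hrank_0_pos[OF assms(1)] by (simp add: rbetti_def)
  have "(\<Sum>k<N. (-1) ^ k * real (rbetti K k)) =
      (\<Sum>k<N. (-1) ^ k * real (hrank K k)) - (\<Sum>k<N. (if k = 0 then 1 else 0))"
    unfolding r sum_subtractf[symmetric] by (intro sum.cong) (auto simp: algebra_simps)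
  also have "(\<Sum>k<N. (if k = 0 then 1 else 0 :: real)) = 1"
    using \<open>N \<noteq> 0\<close> by simp
  also have "(\<Sum>k<N. (-1) ^ k * real (hrank K k)) =
      (\<Sum>k<N. (-1) ^ k * real (card (ksimplices K k)))"
    by (rule Euler_Poincare) (use bound in \<open>force simp: ksimplices_def\<close>)
  also have "\<dots> = (\<Sum>k<N. \<Sum>s\<in>{s \<in> K. card s - 1 = k}. (-1) ^ (card s - 1))"
  proof (intro sum.cong refl)
    fix k
    have "ksimplices K k = {s \<in> K. card s - 1 = k}"
      using simplex by (auto simp: ksimplices_def) (metis Suc_pred card_gt_0_iff)
    then show "(-1) ^ k * real (card (ksimplices K k)) =
        (\<Sum>s\<in>{s \<in> K. card s - 1 = k}. (-1) ^ (card s - 1))"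
      by simp
  qed
  also have "\<dots> = (\<Sum>s\<in>K. (-1) ^ (card s - 1))"
    using bound \<open>N \<noteq> 0\<close> by (intro sum.group finite_K) force+
  finally show ?thesis .
qed

lemma rbetti_above_dim:
  assumes "\<And>s. s \<in> K \<Longrightarrow> card s \<le> k" and "k > 0"
  shows "rbetti K k = 0"
proof -
  have "s \<notin> ksimplices K k" for s
    using assms(1)[of s] by (auto simp: ksimplices_def)
  then have "ksimplices K k = {}" by blast
  then show ?thesis
    using assms(2) cycle_rank_Suc[of "k - 1"] by (simp add: rbetti_def hrank_eq)
qed

end

section \<open>Subadditivity of the linear entropy\<close>

text \<open>Cholesky decomposition by induction on the index set: split off the rank-one part
  through the pivot \<open>M a a\<close> and continue with the Schur complement. It will reduce
  positivity statements about \<rho> \<otimes> \<rho> to single product vectors.\<close>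

lemma psd_Gram:
  fixes M :: "'a \<Rightarrow> 'a \<Rightarrow> complex"
  assumes "finite I"
    and "\<And>x y. x \<in> I \<Longrightarrow> y \<in> I \<Longrightarrow> M y x = cnj (M x y)"
    and "\<And>v. Re (\<Sum>x\<in>I. \<Sum>y\<in>I. cnj (v x) * M x y * v y) \<ge> 0"
  shows "\<exists>u. \<forall>x\<in>I. \<forall>y\<in>I. M x y = (\<Sum>k\<in>I. u k x * cnj (u k y))"
  using assms
proof (induction I arbitrary: M rule: finite_induct)
  case empty
  show ?case by simp
next
  case (insert a I)
  note herm = insert.prems(1) and psd = insert.prems(2)
  have cnj_mult_self: "cnj z * z = of_real ((cmod z)\<^sup>2)" for z
    by (simp only: complex_norm_square mult.commute)
  define r where "r = Re (M a a)"
  have "M a a = cnj (M a a)" using herm by blast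
  then have Maa: "M a a = of_real r"
    unfolding r_def by (metis Reals_cnj_iff of_real_Re)
  have cnjM: "cnj (M a x) = M x a" "cnj (M x a) = M a x" if "x \<in> I" for x
    using herm[of a x] that by auto
  define s where "s v = (\<Sum>y\<in>I. M a y * v y)" for v
  have cnj_s: "cnj (s v) = (\<Sum>x\<in>I. cnj (v x) * M x a)" for v
    unfolding s_def using cnjM by (simp add: mult.commute)
  have expand: "(\<Sum>x\<in>insert a I. \<Sum>y\<in>insert a I. cnj ((v(a := t)) x) * M x y * (v(a := t)) y) =
      of_real r * (cnj t * t) + cnj t * s v + cnj (s v) * t
        + (\<Sum>x\<in>I. \<Sum>y\<in>I. cnj (v x) * M x y * v y)" for v t
  proof -
    have upd: "(v(a := t)) x = v x" if "x \<in> I" for x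
      using insert.hyps that by auto
    have "(\<Sum>x\<in>insert a I. \<Sum>y\<in>insert a I. cnj ((v(a := t)) x) * M x y * (v(a := t)) y) =
      cnj t * M a a * t + (\<Sum>y\<in>I. cnj t * M a y * v y)
        + (\<Sum>x\<in>I. cnj (v x) * M x a * t + (\<Sum>y\<in>I. cnj (v x) * M x y * v y))"
      unfolding sum.insert[OF insert.hyps] fun_upd_same
      by (intro arg_cong2[where f = "(+)"] sum.cong refl) (simp_all only: upd)
    then show ?thesis
      unfolding cnj_s unfolding s_def
      by (simp add: Maa sum.distrib sum_distrib_left sum_distrib_right algebra_simps)
  qed
  have ge0: "0 \<le> r * (cmod t)\<^sup>2 + 2 * Re (cnj t * s v)
      + Re (\<Sum>x\<in>I. \<Sum>y\<in>I. cnj (v x) * M x y * v y)" for v t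
  proof -
    have "of_real r * (cnj t * t) = of_real (r * (cmod t)\<^sup>2)"
      unfolding cnj_mult_self by simp
    moreover have "Re (cnj (s v) * t) = Re (cnj t * s v)"
      by (simp add: algebra_simps)
    ultimately show ?thesis
      using psd[of "v(a := t)"] unfolding expand by (simp only: plus_complex.sel Re_complex_of_real)
  qed
  have "r \<ge> 0" using ge0[where v = "\<lambda>_. 0" and t = 1] by (simp add: s_def)
  \<comment> \<open>With a zero pivot the form in \<open>ge0\<close> is affine along
    \<open>t = - l * M a y\<close>; \<open>l\<close> is chosen so that its value would be
    -1.\<close>
  have row0: "M a y = 0" if "r = 0" "y \<in> I" for y
  proof (rule ccontr)
    assume nz: "M a y \<noteq> 0"
    define l where "l = (Re (M y y) + 1) / (2 * (cmod (M a y))\<^sup>2)"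
    define v :: "'a \<Rightarrow> complex" where "v = (\<lambda>x. if x = y then 1 else 0)"
    have delta: "(\<Sum>z\<in>I. f z * v z) = f y" for f :: "'a \<Rightarrow> complex"
    proof -
      have "(\<Sum>z\<in>I. f z * v z) = (\<Sum>z\<in>I. if z = y then f z else 0)"
        by (rule sum.cong) (auto simp: v_def)
      then show ?thesis using insert.hyps(1) that(2) by simp
    qed
    have sv: "s v = M a y"
      unfolding s_def by (rule delta)
    have "(\<Sum>x\<in>I. \<Sum>z\<in>I. cnj (v x) * M x z * v z) = (\<Sum>x\<in>I. M x y * v x)"
      by (intro sum.cong refl, subst delta) (auto simp: v_def)
    also have "\<dots> = M y y" by (rule delta)
    finally have qv: "(\<Sum>x\<in>I. \<Sum>z\<in>I. cnj (v x) * M x z * v z) = M y y" .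
    have "cnj (- of_real l * M a y) * M a y = of_real (- l * (cmod (M a y))\<^sup>2)"
      using cnj_mult_self[of "M a y"] by (simp add: mult.assoc)
    then have "Re (cnj (- of_real l * M a y) * M a y) = - l * (cmod (M a y))\<^sup>2"
      by (simp only: Re_complex_of_real)
    then have "0 \<le> - 2 * l * (cmod (M a y))\<^sup>2 + Re (M y y)"
      using ge0[where v = v and t = "- of_real l * M a y"] unfolding sv qv \<open>r = 0\<close> by linarith
    also have "\<dots> = -1" using nz by (simp add: l_def field_simps)
    finally show False by simp
  qed
  \<comment> \<open>The Schur complement. For \<open>r = 0\<close> the quotient is 0 by convention
    and \<open>M'\<close> is \<open>M\<close>, which fits \<open>row0\<close>.\<close>
  define M' where "M' x y = M x y - M x a * M a y / of_real r" for x y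
  have "\<exists>u. \<forall>x\<in>I. \<forall>y\<in>I. M' x y = (\<Sum>k\<in>I. u k x * cnj (u k y))"
  proof (rule insert.IH)
    show "M' y x = cnj (M' x y)" if "x \<in> I" "y \<in> I" for x y
      using that herm[of x y] cnjM by (simp add: M'_def mult.commute)
    show "0 \<le> Re (\<Sum>x\<in>I. \<Sum>y\<in>I. cnj (v x) * M' x y * v y)" for v
    proof -
      have "(\<Sum>x\<in>I. \<Sum>y\<in>I. cnj (v x) * M' x y * v y) =
          (\<Sum>x\<in>I. \<Sum>y\<in>I. cnj (v x) * M x y * v y) - cnj (s v) * s v / of_real r"
        unfolding M'_def cnj_s
        by (simp add: s_def sum_product sum_divide_distrib algebra_simps sum_subtractf)
           (rule sum.swap)
      also have "cnj (s v) * s v / of_real r = of_real ((cmod (s v))\<^sup>2 / r)"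
        unfolding cnj_mult_self by simp
      finally have eq: "Re (\<Sum>x\<in>I. \<Sum>y\<in>I. cnj (v x) * M' x y * v y) =
          Re (\<Sum>x\<in>I. \<Sum>y\<in>I. cnj (v x) * M x y * v y) - (cmod (s v))\<^sup>2 / r" by simp
      \<comment> \<open>For positive \<open>r\<close>, \<open>t = - s v / r\<close> minimises the
        quadratic in \<open>ge0\<close>, and the minimum is the form of \<open>M'\<close> at
        \<open>v\<close>. For \<open>r = 0\<close> all the correction terms are 0.\<close>
      have cross: "cnj (- s v / of_real r) * s v = of_real (- (cmod (s v))\<^sup>2 / r)"
        using cnj_mult_self[of "s v"] by simp
      have "r * (cmod (- s v / of_real r))\<^sup>2 = (cmod (s v))\<^sup>2 / r"
        by (simp add: norm_divide power_divide power2_eq_square)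
      then show ?thesis
        using ge0[where v = v and t = "- s v / of_real r"]
        unfolding eq cross Re_complex_of_real by simp
    qed
  qed
  then obtain u' where u': "\<And>x y. x \<in> I \<Longrightarrow> y \<in> I \<Longrightarrow> M' x y = (\<Sum>k\<in>I. u' k x * cnj (u' k y))"
    by blast
  \<comment> \<open>The new vector is column \<open>a\<close> divided by the square root of the
    pivot; the old vectors are extended by 0 at \<open>a\<close>.\<close>
  define u where "u k x = (if k = a then M x a / of_real (sqrt r) else if x = a then 0 else u' k x)"
    for k x
  have sq: "complex_of_real (sqrt r) * of_real (sqrt r) = of_real r"
    using \<open>r \<ge> 0\<close> by (simp flip: of_real_mult)
  have ua: "u a x * cnj (u a y) = M x a * M a y / of_real r"
    if "x \<in> insert a I" "y \<in> insert a I" for x y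
    using herm[of a y] that by (simp add: u_def sq)
  have "M x y = (\<Sum>k\<in>insert a I. u k x * cnj (u k y))"
    if xy: "x \<in> insert a I" "y \<in> insert a I" for x y
  proof -
    have "(\<Sum>k\<in>insert a I. u k x * cnj (u k y)) =
        M x a * M a y / of_real r + (\<Sum>k\<in>I. u k x * cnj (u k y))"
      using insert.hyps ua[OF xy] by simp
    also have "\<dots> = M x y"
    proof (cases "x = a \<or> y = a")
      case True
      then have "(\<Sum>k\<in>I. u k x * cnj (u k y)) = 0"
        using insert.hyps by (intro sum.neutral) (auto simp: u_def)
      moreover have "M x a * M a y / of_real r = M x y"
        using True xy Maa row0 cnjM(1) by (cases "r = 0") auto
      ultimately show ?thesis by simp
    next
      case False
      then have "(\<Sum>k\<in>I. u k x * cnj (u k y)) = (\<Sum>k\<in>I. u' k x * cnj (u' k y))"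
        using insert.hyps by (intro sum.cong) (auto simp: u_def)
      moreover have "M' x y = (\<Sum>k\<in>I. u' k x * cnj (u' k y))"
        using False xy by (intro u') auto
      ultimately show ?thesis unfolding M'_def by (metis add.commute diff_add_cancel)
    qed
    finally show ?thesis ..
  qed
  then show ?case by blast
qed

text \<open>The vector \<open>d = (1 - f) (1 - g) w\<close> is antisymmetric under both \<open>f\<close> and \<open>g\<close>, and
  \<open>(1 - f) (1 - g)\<close> is four times a projection.\<close>

lemma commuting_involutions_nonneg:
  fixes w :: "'a \<Rightarrow> complex"
  assumes f: "\<And>p. p \<in> S \<Longrightarrow> f p \<in> S" "\<And>p. p \<in> S \<Longrightarrow> f (f p) = p"
    and g: "\<And>p. p \<in> S \<Longrightarrow> g p \<in> S" "\<And>p. p \<in> S \<Longrightarrow> g (g p) = p"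
    and comm: "\<And>p. p \<in> S \<Longrightarrow> f (g p) = g (f p)"
  shows "Re (\<Sum>p\<in>S. w p * cnj (w p - w (f p) - w (g p) + w (f (g p)))) \<ge> 0"
proof -
  define d where "d p = w p - w (f p) - w (g p) + w (f (g p))" for p
  have anti: "d (f p) = - d p" "d (g p) = - d p" if "p \<in> S" for p
    using that by (simp_all add: d_def f g comm)
  \<comment> \<open>Since \<open>d\<close> changes sign under \<open>f\<close> and \<open>g\<close>,
    each of the four terms of \<open>d\<close> pairs with \<open>d\<close> to the same value, so the
    squared norm of \<open>d\<close> is \<open>4 * ?s\<close>.\<close>
  have reindex: "(\<Sum>p\<in>S. h (e p) * cnj (d p)) = - (\<Sum>p\<in>S. h p * cnj (d p))"
    if "\<And>p. p \<in> S \<Longrightarrow> e p \<in> S" "\<And>p. p \<in> S \<Longrightarrow> e (e p) = p" "\<And>p. p \<in> S \<Longrightarrow> d (e p) = - d p"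
    for h :: "'a \<Rightarrow> complex" and e
    unfolding sum_negf[symmetric]
    by (rule sum.reindex_bij_witness[of _ e e]) (auto simp: that)
  let ?s = "\<Sum>p\<in>S. w p * cnj (d p)"
  have "(\<Sum>p\<in>S. d p * cnj (d p)) =
      ?s - (\<Sum>p\<in>S. w (f p) * cnj (d p)) - (\<Sum>p\<in>S. w (g p) * cnj (d p))
      + (\<Sum>p\<in>S. w (f (g p)) * cnj (d p))"
    by (simp only: d_def[of "_"] sum_subtractf[symmetric] sum.distrib[symmetric])
       (simp add: algebra_simps)
  also have "\<dots> = 4 * ?s"
    using reindex[of f w, OF f anti(1)] reindex[of g w, OF g anti(2)]
      reindex[of g "\<lambda>p. w (f p)", OF g anti(2)] by simp
  finally have "4 * ?s = (\<Sum>p\<in>S. of_real ((cmod (d p))\<^sup>2))"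
    by (simp only: complex_norm_square)
  then have "4 * Re ?s = (\<Sum>p\<in>S. (cmod (d p))\<^sup>2)"
    by (auto dest: arg_cong[of _ _ Re])
  moreover have "(\<Sum>p\<in>S. (cmod (d p))\<^sup>2) \<ge> 0" by (simp add: sum_nonneg)
  ultimately show ?thesis unfolding d_def[symmetric] by linarith
qed

section \<open>Exchanging qubits between two copies of the system\<close>

lemma finite_configs [simp]: "finite J \<Longrightarrow> finite (configs J)"
  by (simp add: configs_def finite_PiE)

lemma join_join [simp]:
  "join J (join J x z) w = join J x w" "join J y (join J x z) = join J y z"
  by (auto simp: join_def)

lemma join_in_configs:
  "x \<in> configs A \<Longrightarrow> y \<in> configs A \<Longrightarrow> join J x y \<in> configs A"
  by (auto simp: configs_def join_def PiE_iff extensional_def)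

lemma sum_configs_join:
  assumes "J \<subseteq> A"
  shows "(\<Sum>x\<in>configs J. \<Sum>z\<in>configs (A - J). h (join J x z)) = (\<Sum>X\<in>configs A. h X)"
  unfolding sum.cartesian_product
  by (rule sum.reindex_bij_witness[of _ "\<lambda>X. (restrict X J, restrict X (A - J))"
        "\<lambda>(x, z). join J x z"])
     (use assms in \<open>auto simp: configs_def join_def PiE_iff extensional_def fun_eq_iff\<close>)

definition swap :: "nat set \<Rightarrow> (nat \<Rightarrow> bool) \<times> (nat \<Rightarrow> bool) \<Rightarrow> (nat \<Rightarrow> bool) \<times> (nat \<Rightarrow> bool)" where
  "swap J p = (join J (snd p) (fst p), join J (fst p) (snd p))"

text \<open>The expectation of the permutation \<open>swap J\<close> of basis states in \<open>\<rho> \<otimes> \<rho>\<close>.\<close>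

definition swap_trace :: "nat \<Rightarrow> ((nat \<Rightarrow> bool) \<Rightarrow> (nat \<Rightarrow> bool) \<Rightarrow> complex) \<Rightarrow> nat set \<Rightarrow> complex" where
  "swap_trace n \<rho> J = (\<Sum>p\<in>configs {0..<n} \<times> configs {0..<n}.
     \<rho> (fst p) (fst (swap J p)) * \<rho> (snd p) (snd (swap J p)))"

lemma swap_swap: "swap J (swap J p) = p"
  by (cases p) (auto simp: swap_def join_def fun_eq_iff)

lemma swap_Un: "J \<inter> L = {} \<Longrightarrow> swap J (swap L p) = swap (J \<union> L) p"
  by (cases p) (auto simp: swap_def join_def fun_eq_iff)

lemma swap_in_configs: "p \<in> configs A \<times> configs A \<Longrightarrow> swap J p \<in> configs A \<times> configs A"
  by (auto simp: swap_def join_in_configs)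

text \<open>The two partial traces bring in environment states \<open>z\<close> and
  \<open>w\<close>. The pairs \<open>(x, z)\<close> and \<open>(y, w)\<close> are basis states of
  the two copies, and the product of matrix entries exchanges their \<open>J\<close>-parts
  only.\<close>

lemma purity_eq_swap_trace:
  assumes "J \<subseteq> {0..<n}"
  shows "(\<Sum>x\<in>configs J. \<Sum>y\<in>configs J. reduced n \<rho> J x y * reduced n \<rho> J y x) = swap_trace n \<rho> J"
proof -
  let ?C = "configs ({0..<n} - J)"
  let ?h = "\<lambda>X X'. \<rho> X (join J X' X) * \<rho> X' (join J X X')"
  have "(\<Sum>x\<in>configs J. \<Sum>y\<in>configs J. reduced n \<rho> J x y * reduced n \<rho> J y x) =
      (\<Sum>x\<in>configs J. \<Sum>y\<in>configs J. \<Sum>z\<in>?C. \<Sum>w\<in>?C. ?h (join J x z) (join J y w))"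
    by (simp add: reduced_def sum_product)
  also have "\<dots> = (\<Sum>x\<in>configs J. \<Sum>z\<in>?C. \<Sum>y\<in>configs J. \<Sum>w\<in>?C. ?h (join J x z) (join J y w))"
    by (intro sum.cong refl sum.swap)
  also have "\<dots> = (\<Sum>X\<in>configs {0..<n}. \<Sum>X'\<in>configs {0..<n}. ?h X X')"
    unfolding sum_configs_join[OF assms, of "\<lambda>X'. ?h _ X'"]
    by (rule sum_configs_join[OF assms, of "\<lambda>X. \<Sum>X'\<in>configs {0..<n}. ?h X X'"])
  finally show ?thesis
    by (simp add: swap_trace_def swap_def sum.cartesian_product case_prod_unfold)
qed

lemma S2_eq_swap_trace: "J \<subseteq> {0..<n} \<Longrightarrow> S2 n \<rho> J = 1 - Re (swap_trace n \<rho> J)"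
  by (simp add: S2_def purity_eq_swap_trace)

lemma swap_trace_empty:
  assumes "density_op n \<rho>"
  shows "swap_trace n \<rho> {} = 1"
proof -
  have "swap_trace n \<rho> {} = (\<Sum>x\<in>configs {0..<n}. \<rho> x x) * (\<Sum>x\<in>configs {0..<n}. \<rho> x x)"
    by (simp add: swap_trace_def swap_def join_def sum_product sum.cartesian_product case_prod_unfold)
  moreover have "(\<Sum>x\<in>configs {0..<n}. \<rho> x x) = 1"
    using assms unfolding density_op_def by blast
  ultimately show ?thesis by simp
qed

text \<open>Conjugation transposes both factors, and reindexing by the involution
  \<open>swap J\<close> undoes this.\<close>

lemma swap_trace_real:
  assumes "density_op n \<rho>"
  shows "swap_trace n \<rho> J = of_real (Re (swap_trace n \<rho> J))"
proof -
  have herm: "cnj (\<rho> x y) = \<rho> y x" if "x \<in> configs {0..<n}" "y \<in> configs {0..<n}" for x y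
    using assms that unfolding density_op_def by metis
  let ?D = "configs {0..<n} \<times> configs {0..<n}"
  have "cnj (swap_trace n \<rho> J) =
      (\<Sum>p\<in>?D. \<rho> (fst (swap J p)) (fst p) * \<rho> (snd (swap J p)) (snd p))"
    unfolding swap_trace_def cnj_sum
  proof (rule sum.cong)
    fix p assume p: "p \<in> ?D"
    then have "swap J p \<in> ?D" by (rule swap_in_configs)
    then show "cnj (\<rho> (fst p) (fst (swap J p)) * \<rho> (snd p) (snd (swap J p))) =
        \<rho> (fst (swap J p)) (fst p) * \<rho> (snd (swap J p)) (snd p)"
      using p by (auto simp: herm mem_Times_iff)
  qed simp
  also have "\<dots> = swap_trace n \<rho> J"
    unfolding swap_trace_def
    by (rule sum.reindex_bij_witness[of _ "swap J" "swap J"])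
       (simp_all only: swap_swap swap_in_configs)
  finally show ?thesis by (metis Reals_cnj_iff of_real_Re)
qed

text \<open>The claim reads \<open>1 - tr J - tr L + tr (J \<union> L) \<ge> 0\<close> for the swap
  traces. A Gram decomposition of \<rho> turns the left side into a sum over product vectors
  \<open>w k l\<close>, each term being nonnegative because \<open>swap J\<close> and
  \<open>swap L\<close> are commuting involutions.\<close>

lemma S2_subadditive:
  assumes \<rho>: "density_op n \<rho>" and "J \<subseteq> {0..<n}" "L \<subseteq> {0..<n}" "J \<inter> L = {}"
  shows "S2 n \<rho> (J \<union> L) \<le> S2 n \<rho> J + S2 n \<rho> L"
proof -
  let ?C = "configs {0..<n}"
  have "\<exists>u. \<forall>x\<in>?C. \<forall>y\<in>?C. \<rho> x y = (\<Sum>k\<in>?C. u k x * cnj (u k y))"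
  proof (rule psd_Gram)
    show "\<rho> y x = cnj (\<rho> x y)" if "x \<in> ?C" "y \<in> ?C" for x y
      using \<rho> that unfolding density_op_def by blast
    show "0 \<le> Re (\<Sum>x\<in>?C. \<Sum>y\<in>?C. cnj (v x) * \<rho> x y * v y)" for v
      using \<rho> unfolding density_op_def by blast
  qed simp
  then obtain u where u: "\<And>x y. x \<in> ?C \<Longrightarrow> y \<in> ?C \<Longrightarrow> \<rho> x y = (\<Sum>k\<in>?C. u k x * cnj (u k y))"
    by blast
  define w where "w k l p = u k (fst p) * u l (snd p)" for k l and p :: "(nat \<Rightarrow> bool) \<times> (nat \<Rightarrow> bool)"
  have tr: "swap_trace n \<rho> K = (\<Sum>k\<in>?C. \<Sum>l\<in>?C. \<Sum>p\<in>?C \<times> ?C. w k l p * cnj (w k l (swap K p)))" for K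
  proof -
    have "swap_trace n \<rho> K = (\<Sum>p\<in>?C \<times> ?C. \<Sum>k\<in>?C. \<Sum>l\<in>?C. w k l p * cnj (w k l (swap K p)))"
      unfolding swap_trace_def
    proof (rule sum.cong)
      fix p assume p: "p \<in> ?C \<times> ?C"
      then have "swap K p \<in> ?C \<times> ?C" by (rule swap_in_configs)
      then show "\<rho> (fst p) (fst (swap K p)) * \<rho> (snd p) (snd (swap K p)) =
          (\<Sum>k\<in>?C. \<Sum>l\<in>?C. w k l p * cnj (w k l (swap K p)))"
        using p by (auto simp: u mem_Times_iff sum_product w_def algebra_simps)
    qed simp
    also have "\<dots> = (\<Sum>k\<in>?C. \<Sum>p\<in>?C \<times> ?C. \<Sum>l\<in>?C. w k l p * cnj (w k l (swap K p)))"
      by (rule sum.swap)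
    also have "\<dots> = (\<Sum>k\<in>?C. \<Sum>l\<in>?C. \<Sum>p\<in>?C \<times> ?C. w k l p * cnj (w k l (swap K p)))"
      by (intro sum.cong refl sum.swap)
    finally show ?thesis .
  qed
  have swap_id: "swap {} p = p" for p by (simp add: swap_def join_def)
  have "swap_trace n \<rho> {} - swap_trace n \<rho> J - swap_trace n \<rho> L + swap_trace n \<rho> (J \<union> L) =
    (\<Sum>k\<in>?C. \<Sum>l\<in>?C. \<Sum>p\<in>?C \<times> ?C. w k l p *
      cnj (w k l p - w k l (swap J p) - w k l (swap L p) + w k l (swap J (swap L p))))"
    by (simp add: tr swap_id swap_Un[OF assms(4)] sum_subtractf sum.distrib algebra_simps)
  also have "Re \<dots> \<ge> 0"
    unfolding Re_sum[of _ ?C]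
    using assms(4) by (intro sum_nonneg commuting_involutions_nonneg swap_swap swap_in_configs)
      (simp_all add: swap_Un Int_commute Un_commute)
  finally show ?thesis
    using assms by (simp add: S2_eq_swap_trace swap_trace_empty)
qed

section \<open>The antisymmetrised expectation\<close>

text \<open>All of \<open>I2\<close>, \<open>Qsq\<close> and \<open>tangle\<close> are the expectation in \<open>\<rho> \<otimes> \<rho>\<close> of the tensor power of
  the two-qubit operator \<open>1 - F\<close>, \<open>F\<close> the flip, whose matrix entries are:\<close>

definition antisym :: "bool \<Rightarrow> bool \<Rightarrow> bool \<Rightarrow> bool \<Rightarrow> complex" where
  "antisym x y x' y' = - of_bool (y = x' \<and> y' = x) + of_bool (y = x \<and> y' = x')"

definition antisym_trace :: "nat \<Rightarrow> ((nat \<Rightarrow> bool) \<Rightarrow> (nat \<Rightarrow> bool) \<Rightarrow> complex) \<Rightarrow> complex" where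
  "antisym_trace n \<rho> = (\<Sum>x\<in>configs {0..<n}. \<Sum>y\<in>configs {0..<n}.
     \<Sum>x'\<in>configs {0..<n}. \<Sum>y'\<in>configs {0..<n}.
       \<rho> x y * \<rho> x' y' * (\<Prod>j<n. antisym (x j) (y j) (x' j) (y' j)))"

text \<open>Expanding the product selects the set \<open>J\<close> of qubits on which the flip term
  is taken. The pointwise conditions glue to equalities of functions because basis states are
  extensional.\<close>

lemma prod_antisym:
  assumes "x \<in> configs {0..<n}" "y \<in> configs {0..<n}" "x' \<in> configs {0..<n}" "y' \<in> configs {0..<n}"
  shows "(\<Prod>j<n. antisym (x j) (y j) (x' j) (y' j)) =
    (\<Sum>J\<in>Pow {0..<n}. (-1) ^ card J * of_bool (y = join J x' x) * of_bool (y' = join J x x'))"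
proof -
  have "(\<Prod>j<n. antisym (x j) (y j) (x' j) (y' j)) =
    (\<Sum>J\<in>Pow {0..<n}. (\<Prod>j\<in>J. - of_bool (y j = x' j \<and> y' j = x j)) *
      (\<Prod>j\<in>{0..<n} - J. of_bool (y j = x j \<and> y' j = x' j)))"
    unfolding antisym_def atLeast0LessThan by (rule prod_add) simp
  also have "\<dots> = (\<Sum>J\<in>Pow {0..<n}. (-1) ^ card J * of_bool (y = join J x' x) * of_bool (y' = join J x x'))"
  proof (intro sum.cong refl)
    fix J assume J: "J \<in> Pow {0..<n}"
    then have fin: "finite J" by (auto intro: finite_subset)
    have prod_of_bool: "(\<Prod>j\<in>B. of_bool (P j)) = (of_bool (\<forall>j\<in>B. P j) :: complex)"
      if "finite B" for B and P :: "nat \<Rightarrow> bool"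
      using that by (induction B rule: finite_induct) auto
    have "(\<forall>j\<in>J. y j = x' j \<and> y' j = x j) \<and> (\<forall>j\<in>{0..<n} - J. y j = x j \<and> y' j = x' j) \<longleftrightarrow>
        y = join J x' x \<and> y' = join J x x'" (is "?P \<and> ?Q \<longleftrightarrow> ?R")
    proof
      assume PQ: "?P \<and> ?Q"
      have "y j = join J x' x j \<and> y' j = join J x x' j" for j
        using PQ assms J by (cases "j \<in> {0..<n}") (auto simp: join_def configs_def PiE_iff extensional_def)
      then show ?R by (auto simp: fun_eq_iff)
    qed (auto simp: join_def)
    then show "(\<Prod>j\<in>J. - of_bool (y j = x' j \<and> y' j = x j)) *
      (\<Prod>j\<in>{0..<n} - J. of_bool (y j = x j \<and> y' j = x' j)) =
      ((-1) ^ card J * of_bool (y = join J x' x) * of_bool (y' = join J x x') :: complex)"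
      unfolding prod_uminus by (simp add: prod_of_bool fin mult.assoc flip: of_bool_conj)
  qed
  finally show ?thesis .
qed

lemma antisym_trace_eq_sum_swap_trace:
  "antisym_trace n \<rho> = (\<Sum>J\<in>Pow {0..<n}. (-1) ^ card J * swap_trace n \<rho> J)"
proof -
  let ?C = "configs {0..<n}" and ?P = "Pow {0..<n}"
  have delta: "(\<Sum>y\<in>?C. f y * of_bool (y = a)) = f a" if "a \<in> ?C" for a and f :: "_ \<Rightarrow> complex"
    using that by (simp add: of_bool_def if_distrib cong: if_cong)
  have "antisym_trace n \<rho> = (\<Sum>x\<in>?C. \<Sum>y\<in>?C. \<Sum>x'\<in>?C. \<Sum>y'\<in>?C. \<Sum>J\<in>?P. (-1) ^ card J * \<rho> x y * \<rho> x' y' *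
      of_bool (y = join J x' x) * of_bool (y' = join J x x'))"
    unfolding antisym_trace_def
    by (intro sum.cong refl) (simp add: prod_antisym sum_distrib_left mult_ac)
  also have "\<dots> = (\<Sum>J\<in>?P. \<Sum>x\<in>?C. \<Sum>y\<in>?C. \<Sum>x'\<in>?C. \<Sum>y'\<in>?C. (-1) ^ card J * \<rho> x y * \<rho> x' y' *
      of_bool (y = join J x' x) * of_bool (y' = join J x x'))"
    by (simp only: sum.swap[where A = ?C and B = ?P])
  also have "\<dots> = (\<Sum>J\<in>?P. \<Sum>x\<in>?C. \<Sum>y\<in>?C. \<Sum>x'\<in>?C. (-1) ^ card J * \<rho> x y * \<rho> x' (join J x x') *
      of_bool (y = join J x' x))"
    by (intro sum.cong refl) (subst delta, auto simp: join_in_configs)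
  also have "\<dots> = (\<Sum>J\<in>?P. \<Sum>x\<in>?C. \<Sum>x'\<in>?C. \<Sum>y\<in>?C. (-1) ^ card J * \<rho> x y * \<rho> x' (join J x x') *
      of_bool (y = join J x' x))"
    by (intro sum.cong refl sum.swap)
  also have "\<dots> = (\<Sum>J\<in>?P. \<Sum>x\<in>?C. \<Sum>x'\<in>?C. (-1) ^ card J * (\<rho> x (join J x' x) * \<rho> x' (join J x x')))"
    by (intro sum.cong refl) (subst delta, auto simp: join_in_configs mult_ac)
  also have "\<dots> = (\<Sum>J\<in>?P. (-1) ^ card J * swap_trace n \<rho> J)"
    by (simp add: swap_trace_def swap_def sum.cartesian_product case_prod_unfold sum_distrib_left)
  finally show ?thesis .
qed

text \<open>The flip is half of the sum of \<open>\<sigma> \<otimes> \<sigma>\<close> over the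
  identity and the three Pauli matrices; here this is checked on all 16 entries.\<close>

lemma sum_pauli_eq_antisym:
  "(\<Sum>i\<in>{0..<4}. (1 / 2) * (if i = 0 then 1 else -1) * (pauli i y x * pauli i y' x')) = antisym x y x' y'"
proof -
  have "{0..<4} = {0, 1, 2, 3::nat}" by auto
  then show ?thesis
    by (cases x; cases y; cases x'; cases y') (simp_all add: pauli_def antisym_def)
qed

text \<open>The prefactor and the sign are products over the qubits, so the sum over multi-indices
  factors into one-qubit sums.\<close>

lemma Qsq_eq_antisym_trace: "Qsq n \<rho> = antisym_trace n \<rho>"
proof -
  let ?C = "configs {0..<n}" and ?P = "{0..<n} \<rightarrow>\<^sub>E {0..<4::nat}"
  let ?c = "\<lambda>x y x' y' j i. (1 / 2) * (if i = 0 then 1 else -1) *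
    (pauli i (y j) (x j) * pauli i (y' j) (x' j))"
  have sgn: "(1 / 2 ^ n) * (-1) ^ card {j \<in> {0..<n}. \<iota> j \<noteq> 0} =
      (\<Prod>j\<in>{0..<n}. (1 / 2) * (if \<iota> j = 0 then 1 else -1) :: complex)" for \<iota> :: "nat \<Rightarrow> nat"
  proof -
    have "(\<Prod>j\<in>{0..<n}. (if \<iota> j = 0 then 1 else -1) :: complex) =
        (\<Prod>j\<in>{j \<in> {0..<n}. \<iota> j \<noteq> 0}. -1)"
      by (rule prod.mono_neutral_cong_right) auto
    then show ?thesis unfolding prod.distrib by (simp add: power_one_over)
  qed
  have Qsq: "(Qcoef n \<rho> \<iota>)\<^sup>2 = (\<Sum>x\<in>?C. \<Sum>y\<in>?C. \<Sum>x'\<in>?C. \<Sum>y'\<in>?C. \<rho> x y * \<rho> x' y' *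
      (\<Prod>j\<in>{0..<n}. pauli (\<iota> j) (y j) (x j) * pauli (\<iota> j) (y' j) (x' j)))" for \<iota>
    by (simp only: power2_eq_square Qcoef_def sum_distrib_right, simp only: sum_distrib_left,
        simp add: prod.distrib mult_ac atLeast0LessThan)
  have "Qsq n \<rho> = (\<Sum>\<iota>\<in>?P. (1 / 2 ^ n) * (-1) ^ card {j \<in> {0..<n}. \<iota> j \<noteq> 0} * (Qcoef n \<rho> \<iota>)\<^sup>2)"
    by (simp add: Qsq_def sum_distrib_left)
  also have "\<dots> = (\<Sum>\<iota>\<in>?P. \<Sum>x\<in>?C. \<Sum>y\<in>?C. \<Sum>x'\<in>?C. \<Sum>y'\<in>?C. \<rho> x y * \<rho> x' y' *
      (\<Prod>j\<in>{0..<n}. ?c x y x' y' j (\<iota> j)))"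
    unfolding sgn Qsq sum_distrib_left prod.distrib by (simp only: mult_ac)
  also have "\<dots> = (\<Sum>x\<in>?C. \<Sum>y\<in>?C. \<Sum>x'\<in>?C. \<Sum>y'\<in>?C. \<Sum>\<iota>\<in>?P. \<rho> x y * \<rho> x' y' *
      (\<Prod>j\<in>{0..<n}. ?c x y x' y' j (\<iota> j)))"
    by (simp only: sum.swap[where A = ?P and B = ?C])
  also have "\<dots> = antisym_trace n \<rho>"
    unfolding antisym_trace_def sum_distrib_left[symmetric]
  proof (intro sum.cong refl arg_cong2[where f = times])
    fix x y x' y'
    have "(\<Sum>\<iota>\<in>?P. \<Prod>j\<in>{0..<n}. ?c x y x' y' j (\<iota> j)) = (\<Prod>j\<in>{0..<n}. \<Sum>i\<in>{0..<4}. ?c x y x' y' j i)"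
      by (rule prod_sum_PiE[symmetric]) auto
    then show "(\<Sum>\<iota>\<in>?P. \<Prod>j\<in>{0..<n}. ?c x y x' y' j (\<iota> j)) = (\<Prod>j<n. antisym (x j) (y j) (x' j) (y' j))"
      unfolding sum_pauli_eq_antisym by (simp add: atLeast0LessThan)
  qed
  finally show ?thesis .
qed

text \<open>Hermiticity makes the conjugate of \<rho> its transpose, which supplies the second copy.
  On one qubit the two factors \<open>pauli 2\<close> multiply to an entry of twice the singlet
  projection.\<close>

lemma tangle_eq_antisym_trace:
  assumes "density_op n \<rho>"
  shows "tangle n \<rho> = antisym_trace n \<rho>"
proof -
  let ?C = "configs {0..<n}"
  have herm: "cnj (\<rho> c d) = \<rho> d c" if "c \<in> ?C" "d \<in> ?C" for c d
    using assms that unfolding density_op_def by metis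
  have "sigmaY_n n b c * sigmaY_n n d a = (\<Prod>j<n. antisym (a j) (b j) (d j) (c j))" for a b c d
  proof -
    have "pauli 2 y y' * pauli 2 x' x = antisym x y x' y'" for x y x' y'
      by (cases x; cases y; cases x'; cases y') (simp_all add: pauli_def antisym_def)
    then show ?thesis by (simp add: sigmaY_n_def flip: prod.distrib)
  qed
  then have "tangle n \<rho> = (\<Sum>a\<in>?C. \<Sum>b\<in>?C. \<Sum>c\<in>?C. \<Sum>d\<in>?C.
      \<rho> a b * \<rho> d c * (\<Prod>j<n. antisym (a j) (b j) (d j) (c j)))"
    unfolding tangle_def by (intro sum.cong refl) (simp add: herm mult_ac)
  also have "\<dots> = antisym_trace n \<rho>"
    unfolding antisym_trace_def by (intro sum.cong refl sum.swap)
  finally show ?thesis .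
qed

section \<open>Alternating sums over subsets\<close>

lemma sum_Pow_alternating:
  assumes "finite A" "A \<noteq> {}"
  shows "(\<Sum>J\<in>Pow A. (-1) ^ card J) = (0 :: 'a :: comm_ring_1)"
proof -
  have "(\<Sum>J\<in>Pow A. (-1) ^ card J) = (\<Prod>x\<in>A. -1 + (1 :: 'a))"
    using prod_add[OF assms(1), of "\<lambda>_. -1 :: 'a" "\<lambda>_. 1"] by simp
  then show ?thesis using assms by (simp add: power_0_left)
qed

text \<open>For \<open>v\<close> in \<open>A\<close>, expand the product over \<open>A\<close> of
  \<open>-1 + of_bool (x \<noteq> v)\<close>: only sets containing \<open>v\<close> survive, while
  every factor with \<open>x \<noteq> v\<close> vanishes.\<close>

lemma sum_Pow_alternating_member:
  assumes "finite A" "A - {v} \<noteq> {}"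
  shows "(\<Sum>J\<in>Pow A. (-1) ^ card J * of_bool (v \<in> J)) = (0 :: 'a :: comm_ring_1)"
proof (cases "v \<in> A")
  case True
  have "(\<Prod>x\<in>A. -1 + of_bool (x \<noteq> v)) = (\<Sum>J\<in>Pow A. (\<Prod>x\<in>J. -1) * (\<Prod>x\<in>A - J. of_bool (x \<noteq> v) :: 'a))"
    by (rule prod_add[OF assms(1)])
  also have "\<dots> = (\<Sum>J\<in>Pow A. (-1) ^ card J * of_bool (v \<in> J))"
  proof (intro sum.cong refl)
    fix J assume "J \<in> Pow A"
    have "(\<Prod>x\<in>A - J. of_bool (x \<noteq> v) :: 'a) = of_bool (v \<in> J)"
    proof (cases "v \<in> J")
      case True
      then show ?thesis by (auto intro!: prod.neutral)
    next
      case False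
      then show ?thesis using \<open>v \<in> A\<close> assms(1) by (simp, intro prod_zero) auto
    qed
    then show "(\<Prod>x\<in>J. -1) * (\<Prod>x\<in>A - J. of_bool (x \<noteq> v) :: 'a) = (-1) ^ card J * of_bool (v \<in> J)"
      by simp
  qed
  finally show ?thesis using assms by (subst (asm) prod_zero) auto
qed (auto intro!: sum.neutral)

lemma sum_nonempty_alternating:
  assumes "finite A"
  shows "(\<Sum>J\<in>Pow A - {{}}. (-1) ^ (card J - 1) * h J) = h {} - (\<Sum>J\<in>Pow A. (-1) ^ card J * (h J :: real))"
proof -
  have "(\<Sum>J\<in>Pow A - {{}}. (-1) ^ (card J - 1) * h J) = (\<Sum>J\<in>Pow A - {{}}. - ((-1) ^ card J * h J))"
  proof (intro sum.cong refl)
    fix J assume "J \<in> Pow A - {{}}"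
    then have "card J = Suc (card J - 1)"
      using assms finite_subset[of J A] by (simp add: card_gt_0_iff)
    then have "(-1 :: real) ^ card J = - ((-1) ^ (card J - 1))"
      by (metis power_Suc mult_minus1)
    then show "(-1) ^ (card J - 1) * h J = - ((-1) ^ card J * h J)" by simp
  qed
  also have "\<dots> = h {} - (\<Sum>J\<in>Pow A. (-1) ^ card J * h J)"
    using assms by (simp add: sum_negf sum.remove[of "Pow A" "{}"])
  finally show ?thesis .
qed

text \<open>The empty set may be added because its entropy is 0; the constants 1 in the entropies
  then cancel, leaving minus the purities.\<close>

lemma I2_eq_antisym_trace:
  assumes \<rho>: "density_op n \<rho>" and "n > 0"
  shows "complex_of_real (I2 n \<rho>) = antisym_trace n \<rho>"
proof -
  have ne: "{0..<n} \<noteq> {}" using \<open>n > 0\<close> by simp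
  have "I2 n \<rho> = S2 n \<rho> {} - (\<Sum>J\<in>Pow {0..<n}. (-1) ^ card J * S2 n \<rho> J)"
    unfolding I2_def by (rule sum_nonempty_alternating) simp
  also have "S2 n \<rho> {} = 0" by (simp add: S2_eq_swap_trace swap_trace_empty[OF \<rho>])
  also have "(\<Sum>J\<in>Pow {0..<n}. (-1) ^ card J * S2 n \<rho> J) =
      (\<Sum>J\<in>Pow {0..<n}. (-1) ^ card J) - (\<Sum>J\<in>Pow {0..<n}. (-1) ^ card J * Re (swap_trace n \<rho> J))"
    unfolding sum_subtractf[symmetric]
    by (intro sum.cong) (auto simp: S2_eq_swap_trace algebra_simps)
  finally have "I2 n \<rho> = (\<Sum>J\<in>Pow {0..<n}. (-1) ^ card J * Re (swap_trace n \<rho> J))"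
    using sum_Pow_alternating[OF _ ne] by simp
  then show ?thesis
    unfolding antisym_trace_eq_sum_swap_trace
    by (simp flip: swap_trace_real[OF \<rho>])
qed

section \<open>The integrated Euler characteristic\<close>

lemma C2_singleton [simp]: "C2 n \<rho> {v} = 0"
  by (simp add: C2_def)

text \<open>The increment is \<open>S2 {v} + S2 J - S2 (insert v J)\<close>, nonnegative by
  subadditivity.\<close>

lemma C2_mono_insert:
  assumes "density_op n \<rho>" "insert v J \<subseteq> {0..<n}" "v \<notin> J"
  shows "C2 n \<rho> J \<le> C2 n \<rho> (insert v J)"
proof -
  have "finite J" using assms(2) by (auto intro: finite_subset)
  then show ?thesis
    using S2_subadditive[of n \<rho> "{v}" J] assms by (simp add: C2_def)
qed

lemma C2_nonneg:
  assumes "density_op n \<rho>" "J \<subseteq> {0..<n}" "J \<noteq> {}"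
  shows "C2 n \<rho> J \<ge> 0"
proof -
  have "finite J" using assms(2) by (auto intro: finite_subset)
  then show ?thesis using assms(3,2)
  proof (induction J rule: finite_ne_induct)
    case (insert v J)
    then show ?case using C2_mono_insert[OF assms(1), of v J] by auto
  qed simp
qed

lemma finite_complex_Gfilt:
  assumes "density_op n \<rho>"
  shows "finite_complex (Gfilt n \<rho> \<epsilon>)"
proof
  show "finite (Gfilt n \<rho> \<epsilon>)"
    by (rule finite_subset[of _ "Pow {0..<n}"]) (auto simp: Gfilt_def)
  show "finite s \<and> s \<noteq> {}" if "s \<in> Gfilt n \<rho> \<epsilon>" for s
    using that by (auto simp: Gfilt_def intro: finite_subset)
  show "s - {v} \<in> Gfilt n \<rho> \<epsilon>" if "s \<in> Gfilt n \<rho> \<epsilon>" "v \<in> s" "s - {v} \<noteq> {}" for s v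
    using that C2_mono_insert[OF assms, of v "s - {v}"]
    by (auto simp: Gfilt_def insert_absorb)
qed

text \<open>After exchanging the sums, the coefficient of each \<open>S2 {v}\<close> is an
  alternating sum over the sets containing \<open>v\<close>, which vanishes once there is a second
  qubit.\<close>

lemma sum_alternating_C2:
  assumes "n \<ge> 2"
  shows "(\<Sum>J\<in>Pow {0..<n} - {{}}. (-1) ^ (card J - 1) * C2 n \<rho> J) = - I2 n \<rho>"
proof -
  let ?A = "{0..<n}"
  have "(\<Sum>J\<in>Pow ?A - {{}}. (-1) ^ (card J - 1) * (\<Sum>v\<in>J. S2 n \<rho> {v})) =
      - (\<Sum>J\<in>Pow ?A. (-1) ^ card J * (\<Sum>v\<in>J. S2 n \<rho> {v}))"
    by (subst sum_nonempty_alternating) auto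
  also have "(\<Sum>J\<in>Pow ?A. (-1) ^ card J * (\<Sum>v\<in>J. S2 n \<rho> {v})) =
      (\<Sum>J\<in>Pow ?A. \<Sum>v\<in>?A. (-1) ^ card J * of_bool (v \<in> J) * S2 n \<rho> {v})"
  proof (intro sum.cong refl)
    fix J assume "J \<in> Pow ?A"
    then have "(\<Sum>v\<in>J. S2 n \<rho> {v}) = (\<Sum>v\<in>?A. of_bool (v \<in> J) * S2 n \<rho> {v})"
      by (intro sum.mono_neutral_cong_left) auto
    then show "(-1) ^ card J * (\<Sum>v\<in>J. S2 n \<rho> {v}) =
        (\<Sum>v\<in>?A. (-1) ^ card J * of_bool (v \<in> J) * S2 n \<rho> {v})"
      by (simp only: sum_distrib_left mult.assoc)
  qed
  also have "\<dots> = (\<Sum>v\<in>?A. (\<Sum>J\<in>Pow ?A. (-1) ^ card J * of_bool (v \<in> J)) * S2 n \<rho> {v})"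
    by (subst sum.swap) (simp only: sum_distrib_right)
  also have "\<dots> = 0"
  proof (intro sum.neutral ballI)
    fix v
    have "(if v = 0 then 1 else 0) \<in> ?A - {v}" using assms by auto
    then have "?A - {v} \<noteq> {}" by blast
    then show "(\<Sum>J\<in>Pow ?A. (-1) ^ card J * of_bool (v \<in> J)) * S2 n \<rho> {v} = 0"
      by (subst sum_Pow_alternating_member) auto
  qed
  finally show ?thesis
    by (simp add: C2_def I2_def right_diff_distrib sum_subtractf)
qed

section \<open>Integrating functions of the sublevel family\<close>

lemma borel_measurable_sublevel_family:
  fixes c :: "'a \<Rightarrow> real" and \<Phi> :: "'a set \<Rightarrow> real"
  assumes "finite D"
  shows "(\<lambda>\<epsilon>. \<Phi> {J \<in> D. c J \<le> \<epsilon>}) \<in> borel_measurable borel"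
  using assms
proof (induction D arbitrary: \<Phi> rule: finite_induct)
  case (insert j D)
  \<comment> \<open>Whether \<open>j\<close> is present is a threshold condition on \<epsilon>;
    \<Phi> is kept arbitrary so that a present \<open>j\<close> can be absorbed into it.\<close>
  have "\<Phi> {J \<in> insert j D. c J \<le> \<epsilon>} =
      (if c j \<le> \<epsilon> then \<Phi> (insert j {J \<in> D. c J \<le> \<epsilon>}) else \<Phi> {J \<in> D. c J \<le> \<epsilon>})" for \<epsilon>
    by (auto intro: arg_cong[where f = \<Phi>])
  then show ?case
    using insert.IH[of \<Phi>] insert.IH[of "\<lambda>K. \<Phi> (insert j K)"] by simp
qed simp

lemma integrable_sublevel_family:
  fixes c :: "'a \<Rightarrow> real" and \<Phi> :: "'a set \<Rightarrow> real"
  assumes "finite D"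
  shows "(\<lambda>\<epsilon>. \<Phi> {J \<in> D. c J \<le> \<epsilon>}) integrable_on {a..b}"
proof (rule measurable_bounded_by_integrable_imp_integrable)
  show "(\<lambda>\<epsilon>. \<Phi> {J \<in> D. c J \<le> \<epsilon>}) \<in> borel_measurable (lebesgue_on {a..b})"
    using borel_measurable_sublevel_family[OF assms, of \<Phi> c]
    by (intro measurable_restrict_space1 measurable_completion) simp
  show "(\<lambda>_. \<Sum>K\<in>Pow D. \<bar>\<Phi> K\<bar>) integrable_on {a..b}" by (rule integrable_const_ivl)
  show "norm (\<Phi> {J \<in> D. c J \<le> \<epsilon>}) \<le> (\<Sum>K\<in>Pow D. \<bar>\<Phi> K\<bar>)" for \<epsilon>
    using assms by (auto intro!: member_le_sum[where f = "\<lambda>K. \<bar>\<Phi> K\<bar>"])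
qed simp

lemma has_integral_step:
  fixes c :: real
  assumes "0 \<le> c" "c \<le> M"
  shows "((\<lambda>\<epsilon>. of_bool (c \<le> \<epsilon>)) has_integral (M - c)) {0..M}"
proof -
  have "((\<lambda>_. 1 :: real) has_integral (M - c)) {c..M}"
    using has_integral_const_real[of "1::real" c M] assms by simp
  then have "((\<lambda>\<epsilon>. if \<epsilon> \<in> {c..M} then 1 else 0 :: real) has_integral (M - c)) {0..M}"
    by (subst has_integral_restrict) (use assms in auto)
  then show ?thesis
    by (rule has_integral_eq[rotated]) auto
qed

lemma euler_int_eq_I2:
  assumes \<rho>: "density_op n \<rho>" and "n \<ge> 2"
  shows "euler_int n \<rho> = I2 n \<rho>"
proof -
  define D where "D = Pow {0..<n} - {{}}"
  \<comment> \<open>Since all values of \<open>C2\<close> on \<open>D\<close> are nonnegative, their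
    sum bounds each of them; from \<open>M\<close> on the complex is the full simplex, a cone with
    apex 0, and its reduced homology vanishes.\<close>
  define M where "M = (\<Sum>J\<in>D. C2 n \<rho> J)"
  let ?G = "Gfilt n \<rho>"
  have finD: "finite D" by (simp add: D_def)
  have nonneg: "C2 n \<rho> J \<ge> 0" if "J \<in> D" for J
    using that C2_nonneg[OF \<rho>] by (auto simp: D_def)
  have le_M: "C2 n \<rho> J \<le> M" if "J \<in> D" for J
    unfolding M_def using that finD nonneg by (intro member_le_sum) auto
  have "M \<ge> 0" unfolding M_def using nonneg by (rule sum_nonneg)
  have G: "?G \<epsilon> = {J \<in> D. C2 n \<rho> J \<le> \<epsilon>}" for \<epsilon>
    by (auto simp: Gfilt_def D_def)
  have vertex: "{0} \<in> ?G \<epsilon>" if "\<epsilon> \<ge> 0" for \<epsilon>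
    using that \<open>n \<ge> 2\<close> by (simp add: Gfilt_def)
  have dim: "card s \<le> n" if "s \<in> ?G \<epsilon>" for s \<epsilon>
    using that card_mono[of "{0..<n}" s] by (simp add: Gfilt_def)
  have full: "rbetti (?G \<epsilon>) k = 0" if "\<epsilon> \<ge> M" for \<epsilon> k
  proof -
    have "?G \<epsilon> = D" using le_M that by (force simp: G)
    then interpret finite_complex D using finite_complex_Gfilt[OF \<rho>, of \<epsilon>] by simp
    show ?thesis unfolding \<open>?G \<epsilon> = D\<close>
      by (rule rbetti_cone[of 0]) (use \<open>n \<ge> 2\<close> in \<open>auto simp: D_def\<close>)
  qed
  have high: "rbetti (?G \<epsilon>) k = 0" if "k \<ge> n" for \<epsilon> k
  proof -
    interpret finite_complex "?G \<epsilon>" by (rule finite_complex_Gfilt[OF \<rho>])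
    show ?thesis using that \<open>n \<ge> 2\<close> dim by (intro rbetti_above_dim) (auto intro: le_trans)
  qed
  have int: "(\<lambda>\<epsilon>. real (rbetti (?G \<epsilon>) k)) integrable_on {0..M}" for k
    unfolding G by (rule integrable_sublevel_family[OF finD, of "\<lambda>K. real (rbetti K k)"])
  have tail: "integral {0..} (\<lambda>\<epsilon>. real (rbetti (?G \<epsilon>) k)) =
      integral {0..M} (\<lambda>\<epsilon>. real (rbetti (?G \<epsilon>) k))" for k
  proof -
    have "{\<epsilon> \<in> {0..} - {0..M}. real (rbetti (?G \<epsilon>) k) \<noteq> 0} = {}"
      using full[of _ k] by (auto simp: not_le intro: less_imp_le)
    moreover have "{\<epsilon> \<in> {0..M} - {0..}. real (rbetti (?G \<epsilon>) k) \<noteq> 0} = {}"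
      by auto
    ultimately show ?thesis by (intro integral_spike_set) (simp_all only: negligible_empty)
  qed
  have "euler_int n \<rho> = (\<Sum>k<n. (-1) ^ k * integral {0..} (\<lambda>\<epsilon>. real (rbetti (?G \<epsilon>) k)))"
    unfolding euler_int_def by (rule suminf_finite) (simp_all add: high)
  also have "\<dots> = (\<Sum>k<n. integral {0..M} (\<lambda>\<epsilon>. (-1) ^ k * real (rbetti (?G \<epsilon>) k)))"
    unfolding tail by simp
  also have "\<dots> = integral {0..M} (\<lambda>\<epsilon>. \<Sum>k<n. (-1) ^ k * real (rbetti (?G \<epsilon>) k))"
    by (rule integral_sum[symmetric]) (simp_all add: integrable_on_cmult_left int)
  also have "\<dots> = integral {0..M} (\<lambda>\<epsilon>. (\<Sum>J\<in>D. (-1) ^ (card J - 1) * of_bool (C2 n \<rho> J \<le> \<epsilon>)) - 1)"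
  proof (rule integral_cong)
    fix \<epsilon> assume "\<epsilon> \<in> {0..M}"
    interpret finite_complex "?G \<epsilon>" by (rule finite_complex_Gfilt[OF \<rho>])
    have "(\<Sum>k<n. (-1) ^ k * real (rbetti (?G \<epsilon>) k)) = (\<Sum>s\<in>?G \<epsilon>. (-1) ^ (card s - 1)) - 1"
      using \<open>\<epsilon> \<in> {0..M}\<close> by (intro reduced_Euler_Poincare[OF vertex] dim) auto
    also have "(\<Sum>s\<in>?G \<epsilon>. (-1) ^ (card s - 1)) =
        (\<Sum>J\<in>D. (-1) ^ (card J - 1) * of_bool (C2 n \<rho> J \<le> \<epsilon>) :: real)"
      unfolding G by (rule sum.mono_neutral_cong_left) (auto simp: finD)
    finally show "(\<Sum>k<n. (-1) ^ k * real (rbetti (?G \<epsilon>) k)) =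
        (\<Sum>J\<in>D. (-1) ^ (card J - 1) * of_bool (C2 n \<rho> J \<le> \<epsilon>)) - 1" .
  qed
  \<comment> \<open>A simplex \<open>J\<close> is present on an interval of length
    \<open>M - C2 J\<close>. The signs over \<open>D\<close> add up to 1, so the cutoff
    \<open>M\<close> cancels below.\<close>
  also have "\<dots> = (\<Sum>J\<in>D. (-1) ^ (card J - 1) * (M - C2 n \<rho> J)) - M"
  proof (intro integral_unique has_integral_diff has_integral_sum has_integral_mult_right has_integral_step)
    show "((\<lambda>_. 1) has_integral M) {0..M}"
      using has_integral_const_real[of "1::real" 0 M] \<open>M \<ge> 0\<close> by simp
  qed (auto simp: finD nonneg le_M)
  also have "\<dots> = M * (\<Sum>J\<in>D. (-1) ^ (card J - 1)) - M - (\<Sum>J\<in>D. (-1) ^ (card J - 1) * C2 n \<rho> J)"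
    by (simp add: sum_subtractf sum_distrib_left algebra_simps)
  also have "(\<Sum>J\<in>D. (-1) ^ (card J - 1)) = (1 :: real)"
    using sum_nonempty_alternating[of "{0..<n}" "\<lambda>_. 1"] \<open>n \<ge> 2\<close>
    by (simp add: D_def sum_Pow_alternating)
  also have "(\<Sum>J\<in>D. (-1) ^ (card J - 1) * C2 n \<rho> J) = - I2 n \<rho>"
    unfolding D_def by (rule sum_alternating_C2[OF \<open>n \<ge> 2\<close>])
  finally show ?thesis by simp
qed

theorem theorem3:
  fixes n :: nat and \<rho> :: "(nat \<Rightarrow> bool) \<Rightarrow> (nat \<Rightarrow> bool) \<Rightarrow> complex"
  assumes "even n" and "n > 0" and "density_op n \<rho>"
  shows "complex_of_real (euler_int n \<rho>) = complex_of_real (I2 n \<rho>)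
       \<and> complex_of_real (I2 n \<rho>) = Qsq n \<rho>
       \<and> Qsq n \<rho> = tangle n \<rho>"
proof -
  \<comment> \<open>Evenness and positivity exclude a single qubit, for which the one-qubit entropy
    would not cancel in the alternating sum of \<open>C2\<close>.\<close>
  have "n \<ge> 2" using assms(1,2) by (auto elim!: evenE)
  then show ?thesis
    using assms(2,3)
    by (simp add: euler_int_eq_I2 I2_eq_antisym_trace Qsq_eq_antisym_trace tangle_eq_antisym_trace)
qed

end
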